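(* Let $\kappa\in\mathcal{L}_1$, let $k$ be its associated Sonine kernel, and let $n\in\mathbb{N}$. For a function $f\in C_{-1,(k)}^{(n)}(0,+\infty)$, the formula $$(\mathbb{I}_{(\kappa)}^{<n>}\,\mathbb{D}_{(k)}^{<n>}\,f)(x)=f(x)-\sum_{j=0}^{n-1}\left(k*\mathbb{D}_{(k)}^{<j>}\,f\right)(0)\,\kappa^{<j+1>}(x)=f(x)-\sum_{j=0}^{n-1}\left(\mathbb{I}_{(k)}\,\mathbb{D}_{(k)}^{<j>}\,f\right)(0)\,\kappa^{<j+1>}(x),\quad x>0,$$ holds valid, where $\mathbb{I}_{(\kappa)}^{<n>}$ is the $n$-fold general fractional integral and $\mathbb{D}_{(k)}^{<n>}$ is the $n$-fold sequential general fractional derivative in the Riemann-Liouville sense.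
   Context: Functions are real-valued functions on $(0,+\infty)$. Convolution: $(f*g)(x)=\int_0^x f(x-\xi)g(\xi)\,d\xi$, $x>0$. Convolution powers: $g^{<1>}=g$ and $g^{<n>}=g*\cdots*g$ ($n$ factors) for $n\ge 2$. Spaces: $C_{-1}(0,+\infty)=\{f:\ f(x)=x^{q}f_1(x),\ x>0,\ \text{for some } q>-1 \text{ and } f_1\in C[0,+\infty)\}$; $C_{-1,0}(0,+\infty)=\{f:\ f(x)=x^{p-1}f_1(x),\ x>0,\ \text{for some } 0<p<1 \text{ and } f_1\in C[0,+\infty)\}$. Sonine kernels: a pair $\kappa,k$ belongs to $\mathcal{L}_1$ if $\kappa,k\in C_{-1,0}(0,+\infty)$ and $(\kappa*k)(x)=1$ for all $x>0$. The function $k$ is called the Sonine kernel associated to $\kappa$; $\kappa\in\mathcal{L}_1$ means that $\kappa$ belongs to such a pair. Operators: $(\mathbb{I}_{(\kappa)}f)(x)=(\kappa*f)(x)$, $(\mathbb{I}_{(k)}f)(x)=(k*f)(x)$, $(\mathbb{D}_{(k)}f)(x)=\frac{d}{dx}(k*f)(x)$. $\mathbb{I}_{(\kappa)}^{<n>}$ and $\mathbb{D}_{(k)}^{<n>}$ are the $n$-fold compositions of $\mathbb{I}_{(\kappa)}$ and $\mathbb{D}_{(k)}$ with themselves, respectively, and $\mathbb{D}_{(k)}^{<0>}f=f$. $C_{-1,(k)}^{(n)}(0,+\infty)=\{f\in C_{-1}(0,+\infty):\ \mathbb{D}_{(k)}^{<j>}f\in C_{-1}(0,+\infty),\ j=1,\dots,n\}$.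 For a function $g$ on $(0,+\infty)$, $g(0)$ denotes the value at $0$ of its continuous extension, i.e. $\lim_{x\to0+}g(x)$. *)

theory Defs
  imports "HOL-Analysis.Analysis"
begin

text \<open>
  Real-valued functions on the half-line $(0,+\infty)$ are represented by total functions
  of type \<^typ>\<open>real \<Rightarrow> real\<close>; all notions below depend only on their values at
  positive arguments.
\<close>

definition conv :: "(real \<Rightarrow> real) \<Rightarrow> (real \<Rightarrow> real) \<Rightarrow> real \<Rightarrow> real" where
  "conv f g x = set_lebesgue_integral lborel {0<..<x} (\<lambda>\<xi>. f (x - \<xi>) * g \<xi>)"

text \<open>
  \<open>conv_pow g n\<close> is $g * \cdots * g$ with \<open>n\<close> factors, bracketed to the right. It is meaningful
  only for \<open>n \<ge> 1\<close>: there is no convolution unit, and \<open>conv_pow g 0\<close> is a dummy value.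
\<close>

definition conv_pow :: "(real \<Rightarrow> real) \<Rightarrow> nat \<Rightarrow> real \<Rightarrow> real" where
  "conv_pow g n = (conv g ^^ (n - 1)) g"

definition C_m1 :: "(real \<Rightarrow> real) set" where
  "C_m1 = {f. \<exists>q f1. q > -1 \<and> continuous_on {0..} f1 \<and> (\<forall>x>0. f x = x powr q * f1 x)}"

definition C_m1_0 :: "(real \<Rightarrow> real) set" where
  "C_m1_0 = {f. \<exists>p f1. 0 < p \<and> p < 1 \<and> continuous_on {0..} f1 \<and>
                       (\<forall>x>0. f x = x powr (p - 1) * f1 x)}"

definition Sonine_L1 :: "((real \<Rightarrow> real) \<times> (real \<Rightarrow> real)) set" where
  "Sonine_L1 = {(\<kappa>, k). \<kappa> \<in> C_m1_0 \<and> k \<in> C_m1_0 \<and> (\<forall>x>0. conv \<kappa> k x = 1)}"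

definition gfi :: "(real \<Rightarrow> real) \<Rightarrow> (real \<Rightarrow> real) \<Rightarrow> real \<Rightarrow> real" where
  "gfi \<kappa> f x = conv \<kappa> f x"

definition gfd :: "(real \<Rightarrow> real) \<Rightarrow> (real \<Rightarrow> real) \<Rightarrow> real \<Rightarrow> real" where
  "gfd k f x = deriv (conv k f) x"

text \<open>
  Since \<^const>\<open>deriv\<close> is total, the existence of each derivative on $(0,+\infty)$, implicit in
  saying that the iterated derivative belongs to \<^const>\<open>C_m1\<close>, is a separate condition.
\<close>

definition C_m1_k :: "(real \<Rightarrow> real) \<Rightarrow> nat \<Rightarrow> (real \<Rightarrow> real) set" where
  "C_m1_k k n = {f \<in> C_m1. \<forall>j\<in>{1..n}.
      (\<forall>x>0. conv k ((gfd k ^^ (j - 1)) f) differentiable (at x)) \<and>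
      (gfd k ^^ j) f \<in> C_m1}"

text \<open>The value at \<open>0\<close> of the continuous extension of a function on $(0,+\infty)$.\<close>

definition val0 :: "(real \<Rightarrow> real) \<Rightarrow> real" where
  "val0 g = Lim (at_right 0) g"

end

theory Submission imports Defs begin

text \<open>
  For $F = \frac{d}{dx}(k * f)$ integrability of $F$ at $0$ gives $k * f = c + 1 * F$ with
  $c = (k * f)(0)$. Convolving with $\kappa$ and using $\kappa * k = 1$ yields
  $1 * f = 1 * (c\kappa + \kappa * F)$, and differentiation gives $\kappa * F = f - c\kappa$,
  since both integrands are continuous. The general case follows by applying this
  identity to the iterated derivatives of $f$.
\<close>

section \<open>Extension by zero and the working class of functions\<close>

text \<open>With both factors extended by zero, the product in a convolution is supported in
  \<open>0 < \<xi> < x\<close>. Convolution thus becomes an integral over the whole line, to which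
  translation, reflection and Fubini apply directly.\<close>

definition zext :: "(real \<Rightarrow> real) \<Rightarrow> real \<Rightarrow> real" where
  "zext f x = indicator {0<..} x * f x"

text \<open>This class contains \<open>C_m1\<close> and is closed under convolution without any
  tracking of exponents at 0. Integrability reaches down to 0, continuity does not.\<close>

definition cont_loc_int :: "(real \<Rightarrow> real) set" where
  "cont_loc_int = {f. continuous_on {0<..} f \<and> (\<forall>x. set_integrable lborel {0<..<x} f)}"

lemma conv_eq_zext: "conv f g x = (\<integral>\<xi>. zext f (x - \<xi>) * zext g \<xi> \<partial>lborel)"
  unfolding conv_def set_lebesgue_integral_def
  by (rule Bochner_Integration.integral_cong) (auto simp: zext_def indicator_def)

text \<open>Lets identities known only at positive arguments, such as
  \<open>conv \<kappa> k x = 1\<close>, be substituted as functions inside another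
  convolution.\<close>

lemma conv_cong:
  assumes "\<And>x. x > 0 \<Longrightarrow> f x = f' x" "\<And>x. x > 0 \<Longrightarrow> g x = g' x"
  shows "conv f g = conv f' g'"
proof -
  have "zext f = zext f'" "zext g = zext g'"
    using assms by (auto simp: zext_def indicator_def)
  then show ?thesis by (simp add: conv_eq_zext fun_eq_iff)
qed

lemma integral_reflect:
  fixes h :: "real \<Rightarrow> real"
  shows "(\<integral>\<xi>. h (x - \<xi>) \<partial>lborel) = (\<integral>\<xi>. h \<xi> \<partial>lborel)"
  using lborel_integral_real_affine[of "-1" h x] by simp

lemma integrable_reflect:
  fixes h :: "real \<Rightarrow> real"
  shows "integrable lborel (\<lambda>\<xi>. h (x - \<xi>)) \<longleftrightarrow> integrable lborel h"
  using lborel_integrable_real_affine_iff[of "-1" h x] by simp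

lemma conv_commute: "conv f g = conv g f"
proof
  fix x
  show "conv f g x = conv g f x"
    unfolding conv_eq_zext
    by (subst integral_reflect[symmetric, where x = x]) (simp add: mult.commute)
qed

lemma zext_measurable:
  assumes "f \<in> cont_loc_int"
  shows "zext f \<in> borel_measurable borel"
proof -
  have "(\<lambda>x. indicator {0<..} x *\<^sub>R f x) \<in> borel_measurable borel"
    using assms unfolding cont_loc_int_def
    by (intro borel_measurable_continuous_on_indicator) auto
  then show ?thesis by (simp add: zext_def[abs_def])
qed

section \<open>Integrability and continuity of convolutions\<close>

lemma bounded_conv_integrable:
  fixes \<phi> h :: "real \<Rightarrow> real"
  assumes "\<phi> \<in> borel_measurable borel" "\<And>y. \<bar>\<phi> y\<bar> \<le> B" "integrable lborel h"
  shows "integrable lborel (\<lambda>\<xi>. \<phi> (x - \<xi>) * h \<xi>)"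
proof (rule Bochner_Integration.integrable_bound)
  show "integrable lborel (\<lambda>\<xi>. B * h \<xi>)" using assms(3) by simp
  have [measurable]: "h \<in> borel_measurable borel" using assms(3) by auto
  note [measurable] = assms(1)
  show "(\<lambda>\<xi>. \<phi> (x - \<xi>) * h \<xi>) \<in> borel_measurable lborel" by measurable
  show "AE \<xi> in lborel. norm (\<phi> (x - \<xi>) * h \<xi>) \<le> norm (B * h \<xi>)"
    by (intro AE_I2) (simp add: abs_mult mult_right_mono order_trans[OF assms(2) abs_ge_self])
qed

text \<open>Dominated convergence along a sequence tending to \<open>x0\<close>, with majorant
  \<open>B * \<bar>h \<xi>\<bar>\<close>. A discontinuity of \<open>\<phi>\<close> matters only if
  \<open>x0 - \<xi>\<close> lies in \<open>S\<close>, that is, for finitely many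
  \<open>\<xi>\<close>.\<close>

lemma bounded_conv_continuous:
  fixes \<phi> h :: "real \<Rightarrow> real"
  assumes m: "\<phi> \<in> borel_measurable borel" and b: "\<And>y. \<bar>\<phi> y\<bar> \<le> B" and h: "integrable lborel h"
    and S: "finite S" "\<And>y. y \<notin> S \<Longrightarrow> isCont \<phi> y"
  shows "isCont (\<lambda>x. \<integral>\<xi>. \<phi> (x - \<xi>) * h \<xi> \<partial>lborel) x0"
proof (unfold continuous_at_sequentially o_def, intro allI impI)
  fix X :: "nat \<Rightarrow> real" assume X: "X \<longlonglongrightarrow> x0"
  note [measurable] = m
  have [measurable]: "h \<in> borel_measurable borel" using h by auto
  show "(\<lambda>n. \<integral>\<xi>. \<phi> (X n - \<xi>) * h \<xi> \<partial>lborel) \<longlonglongrightarrow> (\<integral>\<xi>. \<phi> (x0 - \<xi>) * h \<xi> \<partial>lborel)"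
  proof (rule integral_dominated_convergence)
    show "integrable lborel (\<lambda>\<xi>. B * \<bar>h \<xi>\<bar>)" using h by simp
    have "finite ((\<lambda>s. x0 - s) ` S)" using S by simp
    then have "AE \<xi> in lborel. \<xi> \<notin> (\<lambda>s. x0 - s) ` S"
      by (intro AE_not_in finite_imp_null_set_lborel)
    then show "AE \<xi> in lborel. (\<lambda>n. \<phi> (X n - \<xi>) * h \<xi>) \<longlonglongrightarrow> \<phi> (x0 - \<xi>) * h \<xi>"
    proof eventually_elim
      case (elim \<xi>)
      have "x0 - \<xi> \<notin> S" using elim by (force simp: image_iff)
      then have "isCont \<phi> (x0 - \<xi>)" by (rule S)
      moreover have "(\<lambda>n. X n - \<xi>) \<longlonglongrightarrow> x0 - \<xi>" using X by (intro tendsto_intros)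
      ultimately have "(\<lambda>n. \<phi> (X n - \<xi>)) \<longlonglongrightarrow> \<phi> (x0 - \<xi>)" by (rule isCont_tendsto_compose)
      then show ?case by (intro tendsto_intros)
    qed
    show "AE \<xi> in lborel. norm (\<phi> (X n - \<xi>) * h \<xi>) \<le> B * \<bar>h \<xi>\<bar>" for n
      using b by (auto simp: abs_mult intro!: mult_right_mono)
  qed measurable
qed

text \<open>For \<open>a > 0\<close> the truncation of a function in \<open>cont_loc_int\<close> is
  bounded, for \<open>a = 0\<close> it is integrable: the two roles in
  \<open>bounded_conv_continuous\<close>. The jumps at \<open>a\<close> and \<open>b\<close> form a
  finite exceptional set.\<close>

definition cutoff :: "real \<Rightarrow> real \<Rightarrow> (real \<Rightarrow> real) \<Rightarrow> real \<Rightarrow> real" where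
  "cutoff a b f y = indicator {a<..<b} y * f y"

lemma cutoff_zero_integrable:
  assumes "f \<in> cont_loc_int"
  shows "integrable lborel (cutoff 0 b f)"
  using assms by (simp add: cont_loc_int_def set_integrable_def cutoff_def[abs_def])

lemma cutoff_zero_atMost_integrable:
  assumes "f \<in> cont_loc_int"
  shows "integrable lborel (\<lambda>\<xi>. indicator {..a} \<xi> * cutoff 0 b f \<xi>)"
  using integrable_mult_indicator[OF _ cutoff_zero_integrable[OF assms, of b], of "{..a}"] by simp

lemma cutoff_bounded:
  assumes "f \<in> cont_loc_int" "0 < a"
  obtains B where "\<And>y. \<bar>cutoff a b f y\<bar> \<le> B"
proof -
  have "compact (f ` {a..b})"
    using assms by (intro compact_continuous_image) (auto simp: cont_loc_int_def intro: continuous_on_subset)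
  then obtain B where "\<forall>y\<in>{a..b}. \<bar>f y\<bar> \<le> B"
    using compact_imp_bounded[of "f ` {a..b}"] by (auto simp: bounded_real)
  \<comment> \<open>The maximum with 0 covers points outside the interval: if \<open>{a..b}\<close>
    is empty, \<open>B\<close> could be negative.\<close>
  then have "\<bar>cutoff a b f y\<bar> \<le> max B 0" for y
    by (cases "y \<in> {a<..<b}") (auto simp: cutoff_def le_max_iff_disj)
  then show thesis by (rule that)
qed

lemma cutoff_measurable:
  assumes "f \<in> cont_loc_int" "0 < a"
  shows "cutoff a b f \<in> borel_measurable borel"
proof -
  have "cutoff a b f = (\<lambda>y. indicator {a<..<b} y * zext f y)"
    using assms by (auto simp: cutoff_def zext_def indicator_def)
  then show ?thesis using zext_measurable[OF assms(1)] by simp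
qed

lemma cutoff_isCont:
  assumes "f \<in> cont_loc_int" "0 < a" "y \<notin> {a, b}"
  shows "isCont (cutoff a b f) y"
proof (cases "y \<in> {a<..<b}")
  case True
  have "isCont f y" using assms True
    by (auto simp: cont_loc_int_def continuous_on_eq_continuous_at)
  moreover have "\<forall>\<^sub>F z in nhds y. cutoff a b f z = f z"
    using True by (intro eventually_mono[OF eventually_nhds_in_open[of "{a<..<b}" y]])
      (auto simp: cutoff_def)
  ultimately show ?thesis by (simp add: isCont_cong)
next
  case False
  have "\<forall>\<^sub>F z in nhds y. cutoff a b f z = 0"
    using assms False by (intro eventually_mono[OF eventually_nhds_in_open[of "- {a..b}" y]])
      (auto simp: cutoff_def)
  then show ?thesis by (simp add: isCont_cong)
qed

text \<open>
  The two factors are singular at opposite ends of the interval of integration. Splitting it at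
  \<open>x0/2\<close> and reflecting the second part leaves two convolutions of a bounded function with an
  integrable one, where none of the functions depends on \<open>x\<close> as long as \<open>x\<close> is near \<open>x0\<close>.
\<close>

lemma
  assumes f: "f \<in> cont_loc_int" and g: "g \<in> cont_loc_int"
    and x: "0 < x0" "3 * x0 / 4 < x" "x < 2 * x0"
  shows conv_split_integrable: "integrable lborel (\<lambda>\<xi>. zext f (x - \<xi>) * zext g \<xi>)"
    and conv_split_eq: "conv f g x =
      (\<integral>\<xi>. cutoff (x0/4) (2*x0) f (x - \<xi>) * (indicator {..x0/2} \<xi> * cutoff 0 (2*x0) g \<xi>) \<partial>lborel)
      + (\<integral>\<xi>. cutoff (x0/2) (2*x0) g (x - \<xi>) * cutoff 0 (2*x0) f \<xi> \<partial>lborel)"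
proof -
  define A where "A = (\<lambda>\<xi>. cutoff (x0/4) (2*x0) f (x - \<xi>) * (indicator {..x0/2} \<xi> * cutoff 0 (2*x0) g \<xi>))"
  define B where "B = (\<lambda>\<xi>. cutoff (x0/2) (2*x0) g (x - \<xi>) * cutoff 0 (2*x0) f \<xi>)"
  \<comment> \<open>\<open>A\<close> carries \<open>\<xi> \<le> x0/2\<close>, where
    \<open>x > 3*x0/4\<close> forces \<open>x - \<xi> > x0/4\<close>; the reflected \<open>B\<close>
    carries \<open>\<xi> > x0/2\<close>. The upper bound \<open>2*x0\<close> exceeds
    \<open>x\<close>, so it cuts off nothing.\<close>
  have eq: "zext f (x - \<xi>) * zext g \<xi> = A \<xi> + B (x - \<xi>)" for \<xi>
    using x by (auto simp: A_def B_def zext_def cutoff_def indicator_def)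
  have "x0/4 > 0" "x0/2 > 0" using x by auto
  obtain C where C: "\<And>y. \<bar>cutoff (x0/4) (2*x0) f y\<bar> \<le> C"
    using cutoff_bounded[OF f \<open>x0/4 > 0\<close>] by blast
  obtain D where D: "\<And>y. \<bar>cutoff (x0/2) (2*x0) g y\<bar> \<le> D"
    using cutoff_bounded[OF g \<open>x0/2 > 0\<close>] by blast
  have A: "integrable lborel A" unfolding A_def
    by (rule bounded_conv_integrable[OF cutoff_measurable[OF f \<open>x0/4 > 0\<close>] C cutoff_zero_atMost_integrable[OF g]])
  have B: "integrable lborel B" unfolding B_def
    by (rule bounded_conv_integrable[OF cutoff_measurable[OF g \<open>x0/2 > 0\<close>] D cutoff_zero_integrable[OF f]])
  then have B': "integrable lborel (\<lambda>\<xi>. B (x - \<xi>))" by (simp add: integrable_reflect)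
  show "integrable lborel (\<lambda>\<xi>. zext f (x - \<xi>) * zext g \<xi>)"
    unfolding eq using A B' by simp
  show "conv f g x = (\<integral>\<xi>. A \<xi> \<partial>lborel) + (\<integral>\<xi>. B \<xi> \<partial>lborel)"
    unfolding conv_eq_zext eq using A B' by (simp add: integral_reflect)
qed

text \<open>For merely integrable factors this would hold at almost every \<open>x\<close>;
  continuity away from 0 gives it at every \<open>x\<close>, as pointwise linearity and
  associativity require.\<close>

lemma conv_integrable:
  assumes "f \<in> cont_loc_int" "g \<in> cont_loc_int"
  shows "integrable lborel (\<lambda>\<xi>. zext f (x - \<xi>) * zext g \<xi>)"
proof (cases "x > 0")
  case True
  then show ?thesis by (intro conv_split_integrable[where ?x0.0 = x] assms) auto
next
  case False
  then have "(\<lambda>\<xi>. zext f (x - \<xi>) * zext g \<xi>) = (\<lambda>_. 0)"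
    by (auto simp: zext_def indicator_def)
  then show ?thesis by simp
qed

lemma conv_continuous:
  assumes f: "f \<in> cont_loc_int" and g: "g \<in> cont_loc_int"
  shows "continuous_on {0<..} (conv f g)"
proof -
  have "isCont (conv f g) x0" if x0: "x0 > 0" for x0
  proof -
    have pos: "x0/4 > 0" "x0/2 > 0" using x0 by auto
    obtain C where C: "\<And>y. \<bar>cutoff (x0/4) (2*x0) f y\<bar> \<le> C"
      using cutoff_bounded[OF f pos(1)] by blast
    obtain D where D: "\<And>y. \<bar>cutoff (x0/2) (2*x0) g y\<bar> \<le> D"
      using cutoff_bounded[OF g pos(2)] by blast
    have h: "integrable lborel (\<lambda>\<xi>. indicator {..x0/2} \<xi> * cutoff 0 (2*x0) g \<xi>)"
      by (rule cutoff_zero_atMost_integrable[OF g])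
    have "\<forall>\<^sub>F x in nhds x0. x \<in> {3*x0/4<..<2*x0}"
      using x0 by (intro eventually_nhds_in_open) auto
    then have "\<forall>\<^sub>F x in nhds x0. conv f g x =
      (\<integral>\<xi>. cutoff (x0/4) (2*x0) f (x - \<xi>) * (indicator {..x0/2} \<xi> * cutoff 0 (2*x0) g \<xi>) \<partial>lborel)
      + (\<integral>\<xi>. cutoff (x0/2) (2*x0) g (x - \<xi>) * cutoff 0 (2*x0) f \<xi> \<partial>lborel)"
      by eventually_elim (intro conv_split_eq f g x0; simp)
    moreover have "isCont (\<lambda>x. 
      (\<integral>\<xi>. cutoff (x0/4) (2*x0) f (x - \<xi>) * (indicator {..x0/2} \<xi> * cutoff 0 (2*x0) g \<xi>) \<partial>lborel)
      + (\<integral>\<xi>. cutoff (x0/2) (2*x0) g (x - \<xi>) * cutoff 0 (2*x0) f \<xi> \<partial>lborel)) x0"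
      \<comment> \<open>The exceptional sets are the jump points of the two cutoffs.\<close>
      by (intro isCont_add
          bounded_conv_continuous[where S = "{x0/4, 2*x0}", OF cutoff_measurable[OF f pos(1)] C h _ cutoff_isCont[OF f pos(1)]]
          bounded_conv_continuous[where S = "{x0/2, 2*x0}", OF cutoff_measurable[OF g pos(2)] D cutoff_zero_integrable[OF f] _ cutoff_isCont[OF g pos(2)]];
          simp)
    ultimately show ?thesis by (simp add: isCont_cong)
  qed
  then show ?thesis by (auto simp: continuous_on_eq_continuous_at)
qed

text \<open>On \<open>{0<..<b}\<close> the convolution sees only the values of both factors on that
  interval. They may be truncated to integrable functions on the line, whose convolution is
  integrable by Fubini.\<close>

lemma conv_loc_integrable:
  assumes f: "f \<in> cont_loc_int" and g: "g \<in> cont_loc_int"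
  shows "set_integrable lborel {0<..<b} (conv f g)"
proof -
  define u where "u = cutoff 0 b f"
  define v where "v = cutoff 0 b g"
  have u: "integrable lborel u" and v: "integrable lborel v"
    unfolding u_def v_def using f g by (auto intro: cutoff_zero_integrable)
  have um[measurable]: "u \<in> borel_measurable borel" and vm[measurable]: "v \<in> borel_measurable borel"
    using u v by auto
  have shift: "integrable lborel (\<lambda>x. h (x - y))" "(\<integral>x. h (x - y) \<partial>lborel) = (\<integral>x. h x \<partial>lborel)"
    if "integrable lborel h" for h :: "real \<Rightarrow> real" and y
    using lborel_integrable_real_affine[OF that, of 1 "- y"]
      lborel_integral_real_affine[of 1 h "- y"] by simp_all
  \<comment> \<open>Integrating absolute values over \<open>x\<close> first makes the inner integral
    a constant multiple of \<open>\<bar>v \<xi>\<bar>\<close>, by translation invariance.\<close>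
  have "integrable (lborel \<Otimes>\<^sub>M lborel) (\<lambda>(\<xi>, x). u (x - \<xi>) * v \<xi>)"
  proof (rule lborel_pair.Fubini_integrable)
    show "(\<lambda>(\<xi>, x). u (x - \<xi>) * v \<xi>) \<in> borel_measurable (lborel \<Otimes>\<^sub>M lborel)" by measurable
    have "(\<lambda>\<xi>. \<integral>x. norm (case (\<xi>, x) of (\<xi>, x) \<Rightarrow> u (x - \<xi>) * v \<xi>) \<partial>lborel)
        = (\<lambda>\<xi>. (\<integral>x. \<bar>u x\<bar> \<partial>lborel) * \<bar>v \<xi>\<bar>)"
      using shift(2)[of "\<lambda>x. \<bar>u x\<bar>"] u by (simp add: abs_mult)
    then show "integrable lborel (\<lambda>\<xi>. \<integral>x. norm (case (\<xi>, x) of (\<xi>, x) \<Rightarrow> u (x - \<xi>) * v \<xi>) \<partial>lborel)"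
      using v by simp
    show "AE \<xi> in lborel. integrable lborel (\<lambda>x. case (\<xi>, x) of (\<xi>, x) \<Rightarrow> u (x - \<xi>) * v \<xi>)"
      using shift(1)[OF u] by simp
  qed
  then have "integrable lborel (\<lambda>x. \<integral>\<xi>. u (x - \<xi>) * v \<xi> \<partial>lborel)"
    using lborel_pair.integrable_snd[of "\<lambda>\<xi> x. u (x - \<xi>) * v \<xi>"] by simp
  then have "set_integrable lborel {0<..<b} (\<lambda>x. \<integral>\<xi>. u (x - \<xi>) * v \<xi> \<partial>lborel)"
    unfolding set_integrable_def by (intro integrable_mult_indicator) auto
  moreover have "(\<integral>\<xi>. u (x - \<xi>) * v \<xi> \<partial>lborel) = conv f g x" if "x \<in> {0<..<b}" for x
    unfolding conv_eq_zext
    by (rule Bochner_Integration.integral_cong)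
      (use that in \<open>auto simp: u_def v_def cutoff_def zext_def indicator_def\<close>)
  ultimately show ?thesis by (subst (asm) set_integrable_cong) auto
qed

section \<open>Closure properties and the algebra of convolution\<close>

lemma cont_loc_int_conv: "f \<in> cont_loc_int \<Longrightarrow> g \<in> cont_loc_int \<Longrightarrow> conv f g \<in> cont_loc_int"
  using conv_continuous conv_loc_integrable by (simp add: cont_loc_int_def)

lemma cont_loc_int_abs: "f \<in> cont_loc_int \<Longrightarrow> (\<lambda>x. \<bar>f x\<bar>) \<in> cont_loc_int"
  by (auto simp: cont_loc_int_def intro: continuous_intros set_integrable_abs)

lemma cont_loc_int_add: "f \<in> cont_loc_int \<Longrightarrow> g \<in> cont_loc_int \<Longrightarrow> (\<lambda>x. f x + g x) \<in> cont_loc_int"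
  by (auto simp: cont_loc_int_def intro: continuous_intros set_integral_add)

lemma cont_loc_int_scale: "f \<in> cont_loc_int \<Longrightarrow> (\<lambda>x. c * f x) \<in> cont_loc_int"
  by (auto simp: cont_loc_int_def intro: continuous_intros)

lemma cont_loc_int_one: "(\<lambda>_. 1) \<in> cont_loc_int"
proof -
  have "set_integrable lborel {0<..<x} (\<lambda>_. 1 :: real)" for x :: real
    by (rule set_integrable_subset[of _ "{0..x}"]) (auto intro: borel_integrable_atLeastAtMost' continuous_intros)
  then show ?thesis by (simp add: cont_loc_int_def)
qed

text \<open>The interval of integration is empty at non-positive arguments, so a convolution can be
  nested in another without truncating again.\<close>

lemma zext_conv: "zext (conv f g) = conv f g"
proof
  fix x
  have "conv f g x = 0" if "x \<le> 0"
    using that by (simp add: conv_def set_lebesgue_integral_def)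
  then show "zext (conv f g) x = conv f g x" by (auto simp: zext_def indicator_def not_less)
qed

lemma conv_add_right:
  assumes "f \<in> cont_loc_int" "g \<in> cont_loc_int" "h \<in> cont_loc_int"
  shows "conv f (\<lambda>x. g x + h x) = (\<lambda>x. conv f g x + conv f h x)"
proof
  fix x
  have "zext (\<lambda>x. g x + h x) = (\<lambda>x. zext g x + zext h x)" by (auto simp: zext_def algebra_simps)
  then show "conv f (\<lambda>x. g x + h x) x = conv f g x + conv f h x"
    using assms by (simp add: conv_eq_zext ring_distribs conv_integrable)
qed

lemma conv_scale_right: "conv f (\<lambda>x. c * g x) = (\<lambda>x. c * conv f g x)"
proof
  fix x
  have "zext (\<lambda>x. c * g x) = (\<lambda>x. c * zext g x)" by (auto simp: zext_def)
  then show "conv f (\<lambda>x. c * g x) x = c * conv f g x"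
    by (simp add: conv_eq_zext mult.left_commute)
qed

text \<open>Both sides are iterated integrals of the same kernel \<open>T\<close>, taken in opposite
  orders.\<close>

lemma conv_assoc:
  assumes f: "f \<in> cont_loc_int" and g: "g \<in> cont_loc_int" and h: "h \<in> cont_loc_int"
  shows "conv (conv f g) h = conv f (conv g h)"
proof
  fix x
  define T where "T = (\<lambda>\<xi> \<eta>. zext f (x - \<xi>) * (zext g (\<xi> - \<eta>) * zext h \<eta>))"
  note [measurable] = zext_measurable[OF f] zext_measurable[OF g] zext_measurable[OF h]
  have z: "\<bar>zext f y\<bar> = zext (\<lambda>x. \<bar>f x\<bar>) y" for f y by (simp add: zext_def abs_mult)
  have int: "integrable (lborel \<Otimes>\<^sub>M lborel) (\<lambda>(\<xi>, \<eta>). T \<xi> \<eta>)"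
  proof (rule lborel_pair.Fubini_integrable)
    show "(\<lambda>(\<xi>, \<eta>). T \<xi> \<eta>) \<in> borel_measurable (lborel \<Otimes>\<^sub>M lborel)" unfolding T_def by measurable
    \<comment> \<open>The absolute values give the same kind of convolution for
      \<open>\<bar>f\<bar>\<close>, \<open>\<bar>g\<bar>\<close>, \<open>\<bar>h\<bar>\<close>,
      which stay in \<open>cont_loc_int\<close>.\<close>
    have "(\<lambda>\<xi>. \<integral>\<eta>. norm (case (\<xi>, \<eta>) of (\<xi>, \<eta>) \<Rightarrow> T \<xi> \<eta>) \<partial>lborel) =
        (\<lambda>\<xi>. zext (\<lambda>x. \<bar>f x\<bar>) (x - \<xi>) * zext (conv (\<lambda>x. \<bar>g x\<bar>) (\<lambda>x. \<bar>h x\<bar>)) \<xi>)"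
      by (simp add: T_def abs_mult zext_conv z) (simp add: conv_eq_zext)
    then show "integrable lborel (\<lambda>\<xi>. \<integral>\<eta>. norm (case (\<xi>, \<eta>) of (\<xi>, \<eta>) \<Rightarrow> T \<xi> \<eta>) \<partial>lborel)"
      by (simp add: conv_integrable cont_loc_int_conv cont_loc_int_abs f g h)
    show "AE \<xi> in lborel. integrable lborel (\<lambda>\<eta>. case (\<xi>, \<eta>) of (\<xi>, \<eta>) \<Rightarrow> T \<xi> \<eta>)"
      using conv_integrable[OF g h] by (simp add: T_def)
  qed
  have inner: "(\<integral>\<xi>. T \<xi> \<eta> \<partial>lborel) = zext (conv f g) (x - \<eta>) * zext h \<eta>" for \<eta>
  proof -
    have "(\<integral>\<xi>. T \<xi> \<eta> \<partial>lborel) = (\<integral>\<xi>. zext f (x - \<xi>) * zext g (\<xi> - \<eta>) \<partial>lborel) * zext h \<eta>"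
      by (simp add: T_def mult.assoc[symmetric])
    also have "(\<integral>\<xi>. zext f (x - \<xi>) * zext g (\<xi> - \<eta>) \<partial>lborel) = conv f g (x - \<eta>)"
      \<comment> \<open>Substitution of \<open>\<eta> + \<xi>\<close> for
        \<open>\<xi>\<close>.\<close>
      using lborel_integral_real_affine[of 1 "\<lambda>\<xi>. zext f (x - \<xi>) * zext g (\<xi> - \<eta>)" \<eta>]
      by (simp add: conv_eq_zext algebra_simps)
    finally show ?thesis by (simp add: zext_conv)
  qed
  have "conv f (conv g h) x = (\<integral>\<xi>. (\<integral>\<eta>. T \<xi> \<eta> \<partial>lborel) \<partial>lborel)"
    unfolding conv_eq_zext[of f] zext_conv by (simp add: T_def conv_eq_zext)
  also have "\<dots> = (\<integral>\<eta>. (\<integral>\<xi>. T \<xi> \<eta> \<partial>lborel) \<partial>lborel)"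
    by (rule lborel_pair.Fubini_integral[OF int, symmetric])
  also have "\<dots> = conv (conv f g) h x"
    by (simp only: inner conv_eq_zext[of "conv f g"])
  finally show "conv (conv f g) h x = conv f (conv g h) x" by simp
qed

section \<open>Convolution with the constant 1 and primitives\<close>

lemma
  assumes f: "f \<in> cont_loc_int"
  shows conv_one_integrable: "f integrable_on {0..x}"
    and conv_one_eq_integral: "conv (\<lambda>_. 1) f = (\<lambda>x. integral {0..x} f)"
proof -
  have *: "set_integrable lborel {0<..<x} f" for x using f by (simp add: cont_loc_int_def)
  show "f integrable_on {0..x}"
    using set_borel_integral_eq_integral(1)[OF *] by (simp add: integrable_on_open_interval_real)
  show "conv (\<lambda>_. 1) f = (\<lambda>x. integral {0..x} f)"
    using set_borel_integral_eq_integral(2)[OF *] by (simp add: fun_eq_iff conv_def integral_open_interval_real)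
qed

lemma conv_one_deriv:
  assumes f: "f \<in> cont_loc_int" and x: "x > 0"
  shows "(conv (\<lambda>_. 1) f has_real_derivative f x) (at x)"
proof -
  have "isCont f x" using f x by (auto simp: cont_loc_int_def continuous_on_eq_continuous_at)
  \<comment> \<open>The right end \<open>x+1\<close> makes \<open>x\<close> an interior point, so
    the derivative within the interval is two-sided.\<close>
  then have "((\<lambda>u. integral {0..u} f) has_vector_derivative f x) (at x within {0..x+1})"
    using x integral_has_vector_derivative_continuous_at[OF conv_one_integrable[OF f], of x "x+1" "{}"]
    by (auto intro: continuous_at_imp_continuous_at_within)
  moreover have "at x within {0..x+1} = at x" using x by (intro at_within_interior) simp
  ultimately show ?thesis
    using conv_one_eq_integral[OF f] by (simp add: has_real_derivative_iff_has_vector_derivative)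
qed

lemma conv_one_tendsto:
  assumes f: "f \<in> cont_loc_int"
  shows "(conv (\<lambda>_. 1) f \<longlongrightarrow> 0) (at_right 0)"
proof -
  have "continuous_on {0..1} (\<lambda>x. integral {0..x} f)"
    by (intro indefinite_integral_continuous_1 conv_one_integrable f)
  then have "((\<lambda>x. integral {0..x} f) \<longlongrightarrow> integral {0..0} f) (at 0 within {0..1})"
    unfolding continuous_on_def by (rule bspec) simp
  then show ?thesis
    using conv_one_eq_integral[OF f] by (simp add: at_within_Icc_at_right)
qed

text \<open>\<open>u\<close> and \<open>conv (\<lambda>_. 1) F\<close> have the same derivative on
  the convex set \<open>{0<..}\<close>, so they differ by a constant. As the latter tends to 0, this
  constant is the limit of \<open>u\<close>; applied to \<open>conv k f\<close>, this proves that
  the value at 0 exists.\<close>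

lemma primitive_eq:
  assumes F: "F \<in> cont_loc_int"
    and u: "\<And>x. x > 0 \<Longrightarrow> (u has_real_derivative F x) (at x)"
  obtains c where "\<And>x. x > 0 \<Longrightarrow> u x = c + conv (\<lambda>_. 1) F x"
    and "(u \<longlongrightarrow> c) (at_right 0)"
proof -
  have "\<exists>c. \<forall>x\<in>{0<..}. u x - conv (\<lambda>_. 1) F x = c"
  proof (rule has_field_derivative_zero_constant)
    fix x :: real assume "x \<in> {0<..}"
    then have "((\<lambda>x. u x - conv (\<lambda>_. 1) F x) has_field_derivative F x - F x) (at x)"
      by (intro DERIV_diff u conv_one_deriv F) auto
    then show "((\<lambda>x. u x - conv (\<lambda>_. 1) F x) has_field_derivative 0) (at x within {0<..})"
      by (simp add: has_field_derivative_at_within)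
  qed simp
  then obtain c where c: "\<And>x. x > 0 \<Longrightarrow> u x = c + conv (\<lambda>_. 1) F x"
    by (force simp: algebra_simps)
  have "((\<lambda>x. c + conv (\<lambda>_. 1) F x) \<longlongrightarrow> c + 0) (at_right 0)"
    by (intro tendsto_intros conv_one_tendsto F)
  moreover have "\<forall>\<^sub>F x in at_right 0. c + conv (\<lambda>_. 1) F x = u x"
    using c by (auto simp: eventually_at_right_less intro: eventually_mono[OF eventually_at_right_less])
  ultimately have "(u \<longlongrightarrow> c) (at_right 0)" by (simp add: tendsto_cong)
  with c show thesis by (rule that)
qed

section \<open>Functions with a power weight at the origin\<close>

text \<open>On a bounded interval \<open>f1\<close> is bounded, and \<open>t powr q\<close> is
  integrable at 0 because \<open>q > -1\<close>.\<close>

lemma cont_loc_int_C_m1: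
  assumes "f \<in> C_m1"
  shows "f \<in> cont_loc_int"
proof -
  obtain q f1 where q: "q > -1" and f1: "continuous_on {0..} f1"
    and f: "\<And>x. x > 0 \<Longrightarrow> f x = x powr q * f1 x"
    using assms by (auto simp: C_m1_def)
  have c: "continuous_on {0<..} f"
  proof (subst continuous_on_cong[OF refl f])
    show "continuous_on {0<..} (\<lambda>x. x powr q * f1 x)"
      by (intro continuous_intros continuous_on_subset[OF f1]) auto
  qed simp
  have "set_integrable lborel {0<..<x} f" if "x > 0" for x
  proof -
    have "compact (f1 ` {0..x})"
      by (intro compact_continuous_image continuous_on_subset[OF f1]) auto
    then obtain B where B: "\<forall>y\<in>{0..x}. \<bar>f1 y\<bar> \<le> B"
      using compact_imp_bounded[of "f1 ` {0..x}"] by (auto simp: bounded_real)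
    \<comment> \<open>From the gauge integral to \<open>lborel\<close>: nonnegativity gives absolute
      integrability, and Borel measurability removes the completion.\<close>
    have "(\<lambda>t. t powr q) integrable_on {0..x}"
      using q that by (intro integrable_on_powr_from_0) auto
    then have "(\<lambda>t. t powr q) absolutely_integrable_on {0..x}"
      by (intro nonnegative_absolutely_integrable_1) auto
    then have "set_integrable lborel {0..x} (\<lambda>t. t powr q)"
      unfolding set_integrable_def by (subst (asm) integrable_completion) auto
    then have "set_integrable lborel {0<..<x} (\<lambda>t. t powr q)"
      by (rule set_integrable_subset) auto
    then have "set_integrable lborel {0<..<x} (\<lambda>t. B * t powr q)" by simp
    then show ?thesis
    proof (rule set_integrable_bound)
      show "set_borel_measurable lborel {0<..<x} f"
        unfolding set_borel_measurable_def
        using borel_measurable_continuous_on_indicator[of "{0<..<x}" f] continuous_on_subset[OF c, of "{0<..<x}"]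
        by (simp add: subset_eq)
      show "AE t in lborel. t \<in> {0<..<x} \<longrightarrow> norm (f t) \<le> norm (B * t powr q)"
      proof (intro AE_I2 impI)
        fix t assume "t \<in> {0<..<x}"
        then have "\<bar>f1 t\<bar> * t powr q \<le> B * t powr q" "f t = t powr q * f1 t"
          using B f by (auto intro!: mult_right_mono)
        then show "norm (f t) \<le> norm (B * t powr q)" by (simp add: abs_mult mult.commute order_trans[OF _ mult_right_mono[OF abs_ge_self]])
      qed
    qed
  qed
  moreover have "set_integrable lborel {0<..<x} f" if "\<not> x > 0" for x
    using that by (simp add: set_integrable_def)
  ultimately show ?thesis using c unfolding cont_loc_int_def by blast
qed

lemma cont_loc_int_C_m1_0: "f \<in> C_m1_0 \<Longrightarrow> f \<in> cont_loc_int"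
  by (rule cont_loc_int_C_m1) (force simp: C_m1_0_def C_m1_def)

section \<open>One derivative followed by one integral\<close>

lemma
  assumes S: "(\<kappa>, k) \<in> Sonine_L1" and f: "f \<in> cont_loc_int"
    and d: "\<And>x. x > 0 \<Longrightarrow> conv k f differentiable (at x)" and F: "gfd k f \<in> cont_loc_int"
  shows conv_tendsto_val0: "(conv k f \<longlongrightarrow> val0 (conv k f)) (at_right 0)"
    and conv_gfd_eq: "x > 0 \<Longrightarrow> conv \<kappa> (gfd k f) x = f x - val0 (conv k f) * \<kappa> x"
proof -
  have \<kappa>: "\<kappa> \<in> cont_loc_int" and k: "k \<in> cont_loc_int"
    and one: "\<And>x. x > 0 \<Longrightarrow> conv \<kappa> k x = 1"
    using S by (auto simp: Sonine_L1_def cont_loc_int_C_m1_0)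
  let ?F = "gfd k f" and ?one = "\<lambda>_::real. 1::real"
  have "(conv k f has_real_derivative ?F x) (at x)" if "x > 0" for x
    using d[OF that] by (simp add: gfd_def DERIV_deriv_iff_real_differentiable)
  from primitive_eq[OF F this] obtain c
    where c: "\<And>x. x > 0 \<Longrightarrow> conv k f x = c + conv ?one ?F x"
      and lim: "(conv k f \<longlongrightarrow> c) (at_right 0)" by blast
  have val: "val0 (conv k f) = c"
    unfolding val0_def by (rule tendsto_Lim[OF _ lim]) simp
  show "(conv k f \<longlongrightarrow> val0 (conv k f)) (at_right 0)" using lim val by simp
  \<comment> \<open>The candidate for \<open>f\<close>. Membership in \<open>cont_loc_int\<close>
    makes it recoverable from its primitive, just like \<open>f\<close>.\<close>
  let ?r = "\<lambda>x. c * \<kappa> x + conv \<kappa> ?F x"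
  have r: "?r \<in> cont_loc_int" by (intro cont_loc_int_add cont_loc_int_scale cont_loc_int_conv \<kappa> F)
  have "conv ?one f = conv (conv \<kappa> k) f"
    using one by (intro conv_cong) auto
  also have "\<dots> = conv \<kappa> (conv k f)" by (rule conv_assoc[OF \<kappa> k f])
  also have "\<dots> = conv \<kappa> (\<lambda>x. c * ?one x + conv ?one ?F x)"
    using c by (intro conv_cong) auto
  also have "\<dots> = (\<lambda>x. c * conv \<kappa> ?one x + conv \<kappa> (conv ?one ?F) x)"
    by (simp only: conv_add_right[OF \<kappa> cont_loc_int_scale[OF cont_loc_int_one] cont_loc_int_conv[OF cont_loc_int_one F]] conv_scale_right)
  \<comment> \<open>The factor 1 moves to the outside, so that both sides become primitives.\<close>
  also have "conv \<kappa> (conv ?one ?F) = conv ?one (conv \<kappa> ?F)"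
    by (simp only: conv_assoc[symmetric] \<kappa> cont_loc_int_one F conv_commute[of \<kappa> ?one])
  also have "(\<lambda>x. c * conv \<kappa> ?one x + conv ?one (conv \<kappa> ?F) x) = conv ?one ?r"
    by (simp only: conv_add_right[OF cont_loc_int_one cont_loc_int_scale[OF \<kappa>] cont_loc_int_conv[OF \<kappa> F]] conv_scale_right
        conv_commute[of \<kappa> ?one])
  finally have eq: "conv ?one f = conv ?one ?r" .
  show "conv \<kappa> ?F x = f x - val0 (conv k f) * \<kappa> x" if "x > 0"
    using DERIV_unique[OF conv_one_deriv[OF f that]] conv_one_deriv[OF r that] val
    by (fastforce simp: eq)
qed

section \<open>Iteration\<close>

lemma cont_loc_int_conv_funpow:
  "\<kappa> \<in> cont_loc_int \<Longrightarrow> g \<in> cont_loc_int \<Longrightarrow> (conv \<kappa> ^^ m) g \<in> cont_loc_int"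
  by (induction m) (auto intro: cont_loc_int_conv)

text \<open>Carries the identity for one derivative, which holds only at positive arguments, through
  the remaining \<open>m\<close> convolutions with \<kappa>.\<close>

lemma conv_funpow_diff:
  assumes \<kappa>: "\<kappa> \<in> cont_loc_int" and g: "g \<in> cont_loc_int" and h: "h \<in> cont_loc_int"
    and e: "\<And>x. x > 0 \<Longrightarrow> e x = g x - c * h x" and "x > 0"
  shows "(conv \<kappa> ^^ m) e x = (conv \<kappa> ^^ m) g x - c * (conv \<kappa> ^^ m) h x"
  using \<open>x > 0\<close>
proof (induction m arbitrary: x)
  case (Suc m)
  have "conv \<kappa> ((conv \<kappa> ^^ m) e) = conv \<kappa> (\<lambda>x. (conv \<kappa> ^^ m) g x + (- c) * (conv \<kappa> ^^ m) h x)"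
    using Suc.IH by (intro conv_cong) auto
  also have "\<dots> = (\<lambda>x. conv \<kappa> ((conv \<kappa> ^^ m) g) x + (- c) * conv \<kappa> ((conv \<kappa> ^^ m) h) x)"
    by (simp only: conv_add_right[OF \<kappa> cont_loc_int_conv_funpow[OF \<kappa> g] cont_loc_int_scale[OF cont_loc_int_conv_funpow[OF \<kappa> h]]]
        conv_scale_right)
  finally show ?case by simp
qed (simp add: e)

lemma gfi_eq_conv: "gfi \<kappa> = conv \<kappa>"
  by (simp add: fun_eq_iff gfi_def)

text \<open>As \<open>val0\<close> is total, the first conjunct certifies that the limits behind it
  exist.\<close>

theorem theorem4p2:
  fixes \<kappa> k f :: "real \<Rightarrow> real" and n :: nat
  assumes "(\<kappa>, k) \<in> Sonine_L1"
    and "n \<ge> 1"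
    and "f \<in> C_m1_k k n"
  shows "(\<forall>j<n. (conv k ((gfd k ^^ j) f) \<longlongrightarrow> val0 (conv k ((gfd k ^^ j) f))) (at_right 0)) \<and>
    (\<forall>x>0.
      (gfi \<kappa> ^^ n) ((gfd k ^^ n) f) x
        = f x - (\<Sum>j=0..n-1. val0 (conv k ((gfd k ^^ j) f)) * conv_pow \<kappa> (j + 1) x) \<and>
      f x - (\<Sum>j=0..n-1. val0 (conv k ((gfd k ^^ j) f)) * conv_pow \<kappa> (j + 1) x)
        = f x - (\<Sum>j=0..n-1. val0 (gfi k ((gfd k ^^ j) f)) * conv_pow \<kappa> (j + 1) x))"
proof -
  define D where "D = (\<lambda>j. (gfd k ^^ j) f)"
  have \<kappa>: "\<kappa> \<in> cont_loc_int" using assms(1) by (auto simp: Sonine_L1_def cont_loc_int_C_m1_0)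
  have DSuc: "D (Suc j) = gfd k (D j)" for j by (simp add: D_def)
  have Din: "D j \<in> cont_loc_int" if "j \<le> n" for j
    using assms(3) that by (intro cont_loc_int_C_m1, cases "j = 0") (simp_all add: D_def C_m1_k_def)
  \<comment> \<open>\<open>C_m1_k\<close> records differentiability of \<open>conv k (D j)\<close>
    under the index \<open>Suc j\<close>.\<close>
  have diff: "conv k (D j) differentiable (at x)" if "j < n" "x > 0" for j x
    using assms(3) that by (auto simp: D_def C_m1_k_def dest!: bspec[of _ _ "Suc j"])
  note S = assms(1) Din[OF less_imp_le] diff Din[OF Suc_leI, unfolded DSuc]
  have lim: "(conv k (D j) \<longlongrightarrow> val0 (conv k (D j))) (at_right 0)" if "j < n" for j
    using that by (intro conv_tendsto_val0[where \<kappa> = \<kappa>] S)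
  \<comment> \<open>Summing over \<open>{..<m}\<close> makes the sum empty at \<open>m = 0\<close>,
    where \<open>{0..m-1}\<close> would contain 0.\<close>
  have *: "(conv \<kappa> ^^ m) (D m) x = f x - (\<Sum>j<m. val0 (conv k (D j)) * (conv \<kappa> ^^ j) \<kappa> x)"
    if "m \<le> n" "x > 0" for m x
    using that(1)
  proof (induction m)
    case 0
    then show ?case by (simp add: D_def)
  next
    case (Suc m)
    \<comment> \<open>The innermost convolution is split off, since that is the one meeting
      \<open>gfd k (D m)\<close>.\<close>
    have "(conv \<kappa> ^^ Suc m) (D (Suc m)) x = (conv \<kappa> ^^ m) (conv \<kappa> (gfd k (D m))) x"
      by (simp only: funpow_Suc_right o_apply DSuc)
    also have "\<dots> = (conv \<kappa> ^^ m) (D m) x - val0 (conv k (D m)) * (conv \<kappa> ^^ m) \<kappa> x"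
      using Suc.prems that(2) by (intro conv_funpow_diff \<kappa> conv_gfd_eq S Din) auto
    finally show ?case using Suc by simp
  qed
  \<comment> \<open>Truncated subtraction requires \<open>n \<ge> 1\<close> here;
    \<open>conv_pow \<kappa> (j + 1)\<close> unfolds to
    \<open>(conv \<kappa> ^^ j) \<kappa>\<close>.\<close>
  have "{..<n} = {0..n-1}" using \<open>n \<ge> 1\<close> by auto
  then have "(conv \<kappa> ^^ n) (D n) x
      = f x - (\<Sum>j=0..n-1. val0 (conv k (D j)) * conv_pow \<kappa> (j + 1) x)" if "x > 0" for x
    using *[of n x] that by (simp add: conv_pow_def)
  with lim show ?thesis by (simp add: gfi_eq_conv D_def)
qed

end
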